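(* For all integers $n\geqslant 0$ and $r\geqslant 1$, (i) $\displaystyle \sum_{k=0}^\infty \left(p(n-rT_{4k})+p(n-rT_{4k+3}) \right) = \frac{S_r(n)}{2}+\frac{U_r(n)}{2}$; (ii) $\displaystyle \sum_{k=0}^\infty \left(p(n-rT_{4k+1})+p(n-rT_{4k+2}) \right) = \frac{S_r(n)}{2}-\frac{U_r(n)}{2}$.
   Context: $p(m)$ denotes the number of integer partitions of $m$, with $p(0)=1$ and $p(m)=0$ for $m<0$. $T_k=k(k+1)/2$. For a partition $\lambda$ and $r\geqslant 1$, $g_r(\lambda)$ is the smallest positive integer whose multiplicity as a part of $\lambda$ is less than $r$ (multiplicity $0$ allowed). $S_r(n)=\sum_{\lambda\vdash n} g_r(\lambda)$. $U_r(n)$ is the number of partitions of $n$ into parts not congruent to $0$, $r$ or $3r$ modulo $4r$. *)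

theory Defs
  imports Complex_Main "HOL-Library.Multiset" "HOL-Number_Theory.Cong"
begin

definition partitions :: "nat \<Rightarrow> nat multiset set" where
  "partitions n = {l. 0 \<notin># l \<and> sum_mset l = n}"

lemma size_le_sum_mset:
  fixes l :: "nat multiset"
  assumes "0 \<notin># l"
  shows "size l \<le> sum_mset l"
  using assms by (induction l) (auto simp: not_less_eq_eq Suc_le_eq)

text \<open>Finiteness guarantees that the cardinalities and the sum over
  \<^term>\<open>partitions n\<close> below carry their intended meaning.\<close>

lemma finite_partitions: "finite (partitions n)"
proof -
  have "l \<in> mset ` {xs. set xs \<subseteq> {..n} \<and> length xs \<le> n}" if "l \<in> partitions n" for l
  proof -
    obtain xs where xs: "l = mset xs" by (metis ex_mset)
    have "set xs \<subseteq> {..n}"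
      using that by (auto simp: xs partitions_def sum_mset_sum_list member_le_sum_list)
    moreover have "length xs \<le> n"
      using that size_le_sum_mset[of l] by (auto simp: xs partitions_def)
    ultimately show ?thesis using xs by blast
  qed
  then have "partitions n \<subseteq> mset ` {xs. set xs \<subseteq> {..n} \<and> length xs \<le> n}" by blast
  then show ?thesis
    by (rule finite_subset) (intro finite_imageI finite_lists_length_le finite_atMost)
qed

definition num_partitions :: "int \<Rightarrow> nat" where
  "num_partitions m = (if m < 0 then 0 else card (partitions (nat m)))"

definition triangular :: "nat \<Rightarrow> nat" where
  "triangular k = k * (k + 1) div 2"

definition least_gap :: "nat \<Rightarrow> nat multiset \<Rightarrow> nat" where
  "least_gap r l = (LEAST i. 0 < i \<and> count l i < r)"

lemma least_gap_wd:
  assumes "r \<ge> 1"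
  shows "0 < least_gap r l \<and> count l (least_gap r l) < r"
proof -
  obtain i where "i \<notin> insert 0 (set_mset l)"
    using ex_new_if_finite[of "insert 0 (set_mset l)"] by auto
  then have "0 < i \<and> count l i < r"
    using assms by (auto simp: count_eq_zero_iff[THEN iffD2])
  then show ?thesis
    unfolding least_gap_def by (rule LeastI)
qed

definition least_gap_sum :: "nat \<Rightarrow> nat \<Rightarrow> nat" where
  "least_gap_sum r n = (\<Sum>l\<in>partitions n. least_gap r l)"

definition num_restricted_partitions :: "nat \<Rightarrow> nat \<Rightarrow> nat" where
  "num_restricted_partitions r n = card {l \<in> partitions n. \<forall>i\<in>#l.
     \<not> [i = 0] (mod 4 * r) \<and> \<not> [i = r] (mod 4 * r) \<and> \<not> [i = 3 * r] (mod 4 * r)}"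

end

theory Submission
  imports Defs "HOL-Computational_Algebra.Formal_Power_Series"
begin

unbundle fps_syntax

text \<open>
  The number of partitions of \<open>n\<close> with \<open>g\<^sub>r > k\<close> is \<open>p(n - r T\<^sub>k)\<close>, since these are the partitions
  containing \<open>r\<close> copies of each of \<open>1, \<dots>, k\<close>; summing over \<open>k\<close> gives \<open>S\<^sub>r(n)\<close>.  The two sums of the
  theorem therefore add up to \<open>S\<^sub>r(n)\<close>.  Their difference is the coefficient of \<open>q\<^sup>n\<close> in
  \<open>P(q) \<Sum>\<^sub>k (-Q)\<^bsup>T\<^sub>k\<^esup>\<close> with \<open>Q = q\<^sup>r\<close>, because \<open>T\<^sub>k\<close> is even exactly for \<open>k \<equiv> 0, 3\<close> modulo 4.  By Gauss's
  identity \<open>\<Sum>\<^sub>k (-Q)\<^bsup>T\<^sub>k\<^esup> = \<Prod>\<^sub>j (1 - Q\<^sup>j) / \<Prod>\<^sub>m (1 - Q\<^bsup>4m+2\<^esup>)\<close>, and multiplying \<open>P(q)\<close> by this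
  quotient removes precisely the parts congruent to \<open>0, r, 3r\<close> modulo \<open>4r\<close>.  Gauss's identity is used
  modulo a power of \<open>Q\<close>, in the finite form due to Shanks.
\<close>

subsection \<open>Triangular numbers and Shanks' identity\<close>

lemma triangular_Suc: "triangular (Suc k) = triangular k + Suc k"
  by (simp add: triangular_def)

lemma le_triangular: "k \<le> triangular k"
  by (induction k) (auto simp: triangular_Suc)

lemma triangular_double: "triangular (2 * n) = n * (2 * n + 1)"
  by (simp add: triangular_def)

text \<open>Shanks' quotient \<open>P_n / P_s\<close>, where \<open>P_n\<close> is the product of
  \<open>(1 - x^(2j)) / (1 - x^(2j-1))\<close> over \<open>1 <= j <= n\<close>, cleared of
  denominators by the product of \<open>1 - x^(2m+1)\<close> over \<open>m < n\<close>. This form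
  makes sense in any commutative ring.\<close>

definition shanks_weight :: "'a::comm_ring_1 \<Rightarrow> nat \<Rightarrow> nat \<Rightarrow> 'a" where
  "shanks_weight x n s = (\<Prod>m=s..<n. 1 - x ^ (2 * m + 2)) * (\<Prod>m<s. 1 - x ^ (2 * m + 1))"

lemma shanks_weight_Suc_left:
  "s \<le> n \<Longrightarrow> shanks_weight x (Suc n) s = (1 - x ^ (2 * n + 2)) * shanks_weight x n s"
  by (simp add: shanks_weight_def mult_ac)

lemma shanks_weight_Suc_right:
  assumes "s < n"
  shows "shanks_weight x n (Suc s) * (1 - x ^ (2 * s + 2)) = shanks_weight x n s * (1 - x ^ (2 * s + 1))"
  using assms by (simp add: shanks_weight_def prod.atLeast_Suc_lessThan mult_ac)

lemma shanks_weight_diag: "shanks_weight x n n = (\<Prod>m<n. 1 - x ^ (2 * m + 1))"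
  by (simp add: shanks_weight_def)

text \<open>Induction on \<open>n\<close> by telescoping. Its use: on the right every term with
  \<open>s >= 1\<close> is divisible by \<open>x^(2n+1)\<close>, so modulo that power only
  \<open>s = 0\<close> survives, which is Gauss's identity.\<close>

lemma shanks_identity:
  fixes x :: "'a::comm_ring_1"
  shows "(\<Prod>m<n. 1 - x ^ (2 * m + 1)) * (\<Sum>s<2 * n. x ^ triangular s)
       = (\<Sum>s<n. shanks_weight x n s * x ^ (s * (2 * n + 1)))"
proof (induction n)
  case (Suc n)
  define D where "D = (\<Prod>m<n. 1 - x ^ (2 * m + 1))"
  \<comment> \<open>Passing from \<open>n\<close> to \<open>n + 1\<close> changes the \<open>s\<close>-th term, apart from the factor
    \<open>1 - x\<^bsup>2n+1\<^esup>\<close>, by \<open>c (s + 1) - c s\<close>.\<close>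
  define c where "c s = x ^ (s * (2 * n + 1)) * shanks_weight x n s * (1 - x ^ (2 * s))" for s
  have step: "shanks_weight x (Suc n) s * x ^ (s * (2 * Suc n + 1))
      = (1 - x ^ (2 * n + 1)) * (shanks_weight x n s * x ^ (s * (2 * n + 1))) + (c (Suc s) - c s)"
    if "s < n" for s
  proof -
    have "c (Suc s) = x ^ (s * (2 * n + 1)) * x ^ (2 * n + 1)
        * (shanks_weight x n (Suc s) * (1 - x ^ (2 * s + 2)))"
      by (simp add: c_def power_add[symmetric] algebra_simps)
    also have "shanks_weight x n (Suc s) * (1 - x ^ (2 * s + 2))
        = shanks_weight x n s * (1 - x * x ^ (2 * s))"
      using shanks_weight_Suc_right[OF that, of x] by simp
    finally have c: "c (Suc s) = x ^ (s * (2 * n + 1)) * (x * x ^ (2 * n))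
        * (shanks_weight x n s * (1 - x * x ^ (2 * s)))" by simp
    have e: "x ^ (s * (2 * Suc n + 1)) = x ^ (s * (2 * n + 1)) * x ^ (2 * s)"
      by (simp add: power_add[symmetric] algebra_simps)
    have w: "shanks_weight x (Suc n) s = (1 - x * x * x ^ (2 * n)) * shanks_weight x n s"
      using that by (simp add: shanks_weight_Suc_left mult_ac)
    \<comment> \<open>With \<open>u = x^(2n)\<close>, \<open>v = x^(2s)\<close>,
      \<open>a = x^(s(2n+1))\<close> and \<open>w\<close> the weight, the step is a polynomial
      identity.\<close>
    have ring: "(1 - x * x * u) * w * (a * v) =
        (1 - x * u) * (w * a) + (a * (x * u) * (w * (1 - x * v)) - a * w * (1 - v))" for a u v w
      by (simp add: algebra_simps)
    then show ?thesis
      unfolding c unfolding e w c_def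
      using ring[of "x ^ (2 * n)" "shanks_weight x n s" "x ^ (s * (2 * n + 1))" "x ^ (2 * s)"] by simp
  qed
  have c0: "c 0 = 0" by (simp add: c_def)
  have cn: "c n = x ^ (n * (2 * n + 1)) * D * (1 - x ^ (2 * n))"
    by (simp add: c_def shanks_weight_diag D_def)
  have last: "shanks_weight x (Suc n) n * x ^ (n * (2 * Suc n + 1))
      = (1 - x * x * x ^ (2 * n)) * D * (x ^ (n * (2 * n + 1)) * x ^ (2 * n))"
    by (simp add: shanks_weight_Suc_left shanks_weight_diag D_def power_add[symmetric] algebra_simps)
  have T: "x ^ triangular (2 * n) = x ^ (n * (2 * n + 1))"
    "x ^ triangular (Suc (2 * n)) = x ^ (n * (2 * n + 1)) * (x * x ^ (2 * n))"
    by (simp_all only: triangular_double triangular_Suc power_add power_Suc)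
  have "(\<Sum>s<n. shanks_weight x (Suc n) s * x ^ (s * (2 * Suc n + 1)))
      = (\<Sum>s<n. (1 - x ^ (2 * n + 1)) * (shanks_weight x n s * x ^ (s * (2 * n + 1))) + (c (Suc s) - c s))"
    by (intro sum.cong refl step) simp
  then have "(\<Sum>s<Suc n. shanks_weight x (Suc n) s * x ^ (s * (2 * Suc n + 1)))
      = (1 - x ^ (2 * n + 1)) * (\<Sum>s<n. shanks_weight x n s * x ^ (s * (2 * n + 1)))
        + (c n - c 0) + shanks_weight x (Suc n) n * x ^ (n * (2 * Suc n + 1))"
    by (simp only: sum.lessThan_Suc sum.distrib sum_distrib_left[symmetric] sum_lessThan_telescope)
  also have "\<dots> = D * (1 - x * x ^ (2 * n)) *
      ((\<Sum>s<2 * n. x ^ triangular s) + x ^ triangular (2 * n) + x ^ triangular (Suc (2 * n)))"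
  proof -
    \<comment> \<open>The boundary term \<open>c n\<close> and the new summand \<open>s = n\<close>
      add up to \<open>a * D * (1 - (x * u)^2)\<close>. Its factor \<open>1 + x * u\<close> yields
      the two new triangular powers \<open>a\<close> and \<open>a * (x * u)\<close>.\<close>
    have "(1 - x * u) * (D * t) + (a * D * (1 - u) - 0) + (1 - x * x * u) * D * (a * u)
        = D * (1 - x * u) * (t + a + a * (x * u))" for a t u
      by (simp add: algebra_simps)
    from this[of "x ^ (2 * n)" "\<Sum>s<2 * n. x ^ triangular s" "x ^ (n * (2 * n + 1))"] show ?thesis
      unfolding Suc.IH[symmetric] D_def[symmetric] c0 cn last T by simp
  qed
  also have "\<dots> = (\<Prod>m<Suc n. 1 - x ^ (2 * m + 1)) * (\<Sum>s<2 * Suc n. x ^ triangular s)"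
    by (simp add: D_def)
  finally show ?case by simp
qed simp

subsection \<open>Generating functions of partitions\<close>

definition partitions_into :: "nat set \<Rightarrow> nat \<Rightarrow> nat multiset set" where
  "partitions_into A n = {l \<in> partitions n. set_mset l \<subseteq> A}"

definition partitions_fps :: "nat set \<Rightarrow> real fps" where
  "partitions_fps A = Abs_fps (\<lambda>n. real (card (partitions_into A n)))"

lemma finite_partitions_into: "finite (partitions_into A n)"
  by (simp add: partitions_into_def finite_partitions)

lemma parts_le: "l \<in> partitions n \<Longrightarrow> i \<in># l \<Longrightarrow> i \<le> n"
  by (auto simp: partitions_def dest: multi_member_split)

lemma partitions_into_cong:
  assumes "\<And>i. 0 < i \<Longrightarrow> i \<le> n \<Longrightarrow> i \<in> A \<longleftrightarrow> i \<in> B"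
  shows "partitions_into A n = partitions_into B n"
proof -
  have "set_mset l \<subseteq> A \<longleftrightarrow> set_mset l \<subseteq> B" if "l \<in> partitions n" for l
  proof -
    have "i \<in> A \<longleftrightarrow> i \<in> B" if "i \<in># l" for i
      using assms[of i] parts_le[OF \<open>l \<in> partitions n\<close> that] \<open>l \<in> partitions n\<close> that
      by (cases "i = 0") (auto simp: partitions_def)
    then show ?thesis by blast
  qed
  then show ?thesis by (auto simp: partitions_into_def)
qed

text \<open>Case split on whether \<open>a\<close> occurs; if so, one copy is removed and
  \<open>a\<close> stays available. This is the recurrence behind the Euler factor
  \<open>1 / (1 - X^a)\<close>.\<close>

lemma partitions_into_insert:
  assumes "a > 0" "a \<notin> A"
  shows "partitions_into (insert a A) n = partitions_into A n \<union>
    (if a \<le> n then add_mset a ` partitions_into (insert a A) (n - a) else {})"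
    (is "?L = ?R")
proof
  show "?L \<subseteq> ?R"
  proof
    fix l assume l: "l \<in> ?L"
    show "l \<in> ?R"
    proof (cases "a \<in># l")
      case False
      then show ?thesis using l by (auto simp: partitions_into_def)
    next
      case True
      then obtain m where m: "l = add_mset a m" by (metis multi_member_split)
      have "a \<le> n" "m \<in> partitions_into (insert a A) (n - a)"
        using l by (auto simp: m partitions_into_def partitions_def)
      then show ?thesis by (simp add: m)
    qed
  qed
  show "?R \<subseteq> ?L"
    using assms by (auto simp: partitions_into_def partitions_def split: if_splits)
qed

lemma partitions_fps_insert:
  assumes "a > 0" "a \<notin> A"
  shows "partitions_fps (insert a A) * (1 - fps_X ^ a) = partitions_fps A"
proof (rule fps_ext)
  fix n
  let ?I = "add_mset a ` partitions_into (insert a A) (n - a)"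
  have disj: "partitions_into A n \<inter> ?I = {}"
    using assms by (auto simp: partitions_into_def)
  have "card ?I = card (partitions_into (insert a A) (n - a))"
    by (rule card_image) (simp add: inj_on_def)
  then have "card (partitions_into (insert a A) n) = card (partitions_into A n) +
    (if a \<le> n then card (partitions_into (insert a A) (n - a)) else 0)"
    using disj unfolding partitions_into_insert[OF assms, of n]
    by (simp add: card_Un_disjoint finite_partitions_into)
  then show "(partitions_fps (insert a A) * (1 - fps_X ^ a)) $ n = partitions_fps A $ n"
    by (auto simp: partitions_fps_def right_diff_distrib fps_X_power_mult_right_nth)
qed

text \<open>Discarding finitely many parts is multiplication by a polynomial, so no infinite product
  has to be formed.\<close>

lemma partitions_fps_Un:
  assumes "finite B" "0 \<notin> B" "A \<inter> B = {}"
  shows "partitions_fps (A \<union> B) * (\<Prod>b\<in>B. 1 - fps_X ^ b) = partitions_fps A"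
  using assms
proof (induction B)
  case (insert b B)
  have "partitions_fps (insert b (A \<union> B)) * (1 - fps_X ^ b) = partitions_fps (A \<union> B)"
    using insert by (intro partitions_fps_insert) auto
  then show ?case
    using insert by (simp add: mult.assoc[symmetric])
qed simp

subsection \<open>The sum of the least gaps\<close>

lemma num_partitions_diff:
  "num_partitions (int n - int m) = (if m \<le> n then card (partitions (n - m)) else 0)"
  by (auto simp: num_partitions_def nat_diff_distrib)

definition repeated_staircase :: "nat \<Rightarrow> nat \<Rightarrow> nat multiset" where
  "repeated_staircase r k = (\<Sum>i=1..k. replicate_mset r i)"

lemma sum_mset_repeated_staircase: "sum_mset (repeated_staircase r k) = r * triangular k"
  by (induction k)
    (simp_all add: repeated_staircase_def triangular_Suc triangular_def[of 0] algebra_simps)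

lemma count_repeated_staircase:
  "count (repeated_staircase r k) i = (if 0 < i \<and> i \<le> k then r else 0)"
  by (induction k) (auto simp: repeated_staircase_def)

lemma less_least_gap_iff:
  assumes "r \<ge> 1"
  shows "k < least_gap r l \<longleftrightarrow> repeated_staircase r k \<subseteq># l"
proof -
  have "k < least_gap r l \<longleftrightarrow> (\<forall>i. 0 < i \<and> i \<le> k \<longrightarrow> r \<le> count l i)"
  proof
    assume "k < least_gap r l"
    then show "\<forall>i. 0 < i \<and> i \<le> k \<longrightarrow> r \<le> count l i"
      using not_less_Least[of _ "\<lambda>i. 0 < i \<and> count l i < r"]
      unfolding least_gap_def by (metis le_less_trans not_less)
  next
    assume "\<forall>i. 0 < i \<and> i \<le> k \<longrightarrow> r \<le> count l i"
    then show "k < least_gap r l"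
      using least_gap_wd[OF assms, of l] by (metis not_less)
  qed
  then show ?thesis by (auto simp: subseteq_mset_def count_repeated_staircase)
qed

text \<open>Removing the staircase, of size \<open>r T_k\<close>, is a bijection onto the partitions
  of the rest. If \<open>r T_k > n\<close>, no such partition exists, in line with
  \<open>p = 0\<close> at negative arguments.\<close>

lemma card_less_least_gap:
  assumes "r \<ge> 1"
  shows "card {l \<in> partitions n. k < least_gap r l} = num_partitions (int n - int (r * triangular k))"
proof (cases "r * triangular k \<le> n")
  case True
  let ?M = "repeated_staircase r k"
  have "{l \<in> partitions n. k < least_gap r l} = (+) ?M ` partitions (n - r * triangular k)" (is "?L = ?R")
  proof
    show "?L \<subseteq> ?R"
    proof
      fix l assume l: "l \<in> ?L"
      then obtain m where m: "l = ?M + m"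
        using less_least_gap_iff[OF assms] by (auto simp: mset_subset_eq_exists_conv)
      have "m \<in> partitions (n - r * triangular k)"
        using l by (auto simp: m partitions_def sum_mset_repeated_staircase)
      then show "l \<in> ?R" by (simp add: m)
    qed
    have "0 \<notin># ?M"
      by (simp add: count_repeated_staircase not_in_iff)
    then show "?R \<subseteq> ?L"
      using True by (auto simp: less_least_gap_iff[OF assms] partitions_def sum_mset_repeated_staircase)
  qed
  also have "card \<dots> = card (partitions (n - r * triangular k))"
    by (rule card_image) (simp add: inj_on_def)
  finally show ?thesis using True by (simp only: num_partitions_diff if_True)
next
  case False
  have "sum_mset (repeated_staircase r k) \<le> sum_mset l" if "k < least_gap r l" for l
    using that less_least_gap_iff[OF assms] by (auto simp: mset_subset_eq_exists_conv)
  then have "{l \<in> partitions n. k < least_gap r l} = {}"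
    using False by (fastforce simp: partitions_def sum_mset_repeated_staircase)
  then show ?thesis using False by (simp only: num_partitions_diff) simp
qed

text \<open>Holds because \<open>k <= T_k <= r T_k\<close>; it allows every series to be cut off at
  any bound above \<open>n\<close>.\<close>

lemma num_partitions_eq_0:
  assumes "r \<ge> 1" "n < k"
  shows "num_partitions (int n - int (r * triangular k)) = 0"
proof -
  have "k \<le> r * triangular k"
    using mult_le_mono[OF assms(1) le_triangular[of k]] by simp
  then show ?thesis using assms(2) by (simp only: num_partitions_diff) simp
qed

text \<open>Each gap \<open>g\<close> is the number of \<open>k < g\<close>; then the two sums are
  interchanged.\<close>

lemma sum_num_partitions_eq_least_gap_sum:
  assumes "r \<ge> 1" "n < K"
  shows "(\<Sum>k<K. num_partitions (int n - int (r * triangular k))) = least_gap_sum r n"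
proof -
  have "least_gap r l = (\<Sum>k<K. if k < least_gap r l then 1 else 0)" if l: "l \<in> partitions n" for l
  proof -
    \<comment> \<open>The cutoff loses nothing: no gap exceeds \<open>K\<close>.\<close>
    have "{l \<in> partitions n. K < least_gap r l} = {}"
      using card_less_least_gap[OF assms(1), of n K] num_partitions_eq_0[OF assms] finite_partitions[of n]
      by simp
    then have "least_gap r l \<le> K" using l by force
    then have "{..<K} \<inter> {k. k < least_gap r l} = {..<least_gap r l}" by auto
    then show ?thesis by (simp add: sum.If_cases)
  qed
  then have "least_gap_sum r n = (\<Sum>l\<in>partitions n. \<Sum>k<K. if k < least_gap r l then 1 else 0)"
    unfolding least_gap_sum_def by (intro sum.cong) auto
  also have "\<dots> = (\<Sum>k<K. card {l \<in> partitions n. k < least_gap r l})"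
    by (subst sum.swap) (simp add: sum.If_cases finite_partitions Int_def)
  finally show ?thesis by (simp add: card_less_least_gap[OF assms(1)])
qed

subsection \<open>The alternating sum\<close>

lemma fps_nth_mult_eq_0:
  fixes f g :: "'a::comm_ring_1 fps"
  assumes "\<And>i. i \<le> n \<Longrightarrow> f $ i = 0"
  shows "(f * g) $ n = 0"
  using assms by (auto simp: fps_mult_nth intro: sum.neutral)

definition allowed_parts :: "nat \<Rightarrow> nat set" where
  "allowed_parts r = {i. 0 < i \<and> \<not> [i = 0] (mod 4 * r) \<and> \<not> [i = r] (mod 4 * r) \<and> \<not> [i = 3 * r] (mod 4 * r)}"

lemma num_restricted_partitions_eq:
  "num_restricted_partitions r n = card (partitions_into (allowed_parts r) n)"
  unfolding num_restricted_partitions_def partitions_into_def allowed_parts_def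
  by (rule arg_cong[of _ _ card]) (auto simp: partitions_def intro!: gr0I)

text \<open>The modulus and the residues \<open>0\<close>, \<open>r\<close>, \<open>3 * r\<close>
  are all multiples of \<open>r\<close>, so non-multiples of \<open>r\<close> pass. For
  \<open>i = r * j\<close> the conditions reduce to \<open>j\<close> modulo 4 and leave only the
  class of 2.\<close>

lemma allowed_parts_iff:
  assumes "0 < i" "0 < r"
  shows "i \<in> allowed_parts r \<longleftrightarrow> \<not> r dvd i \<or> (\<exists>m. i = r * (4 * m + 2))"
proof (cases "r dvd i")
  case True
  then obtain j where j: "i = r * j" by blast
  have cong: "[r * j = r * c] (mod 4 * r) \<longleftrightarrow> j mod 4 = c mod 4" for c
    using assms by (simp add: cong_def mult.commute[of 4] mult_mod_right[symmetric])
  have "i \<in> allowed_parts r \<longleftrightarrow> j mod 4 \<noteq> 0 \<and> j mod 4 \<noteq> 1 \<and> j mod 4 \<noteq> 3"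
    using cong[of 0] cong[of 1] cong[of 3] assms by (simp add: allowed_parts_def j mult.commute)
  also have "\<dots> \<longleftrightarrow> j mod 4 = 2" by presburger
  also have "\<dots> \<longleftrightarrow> (\<exists>m. j = 4 * m + 2)" by presburger
  also have "\<dots> \<longleftrightarrow> (\<exists>m. i = r * (4 * m + 2))" using assms by (simp only: j mult_cancel1) simp
  finally show ?thesis using True by simp
next
  case False
  have "\<not> [i = c] (mod 4 * r)" if "r dvd c" for c
    using False that cong_dvd_iff[of i c r] cong_modulus_mult_nat[of i c r 4]
    by (metis mult.commute)
  then show ?thesis using False assms by (simp add: allowed_parts_def)
qed

text \<open>The two generating functions are multiplied by a polynomial \<open>E\<close> with
  constant term 1 and compared through degree \<open>n\<close> only; then \<open>E\<close> is
  cancelled.\<close>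

lemma alternating_sum_num_partitions:
  assumes r: "r \<ge> 1" and N: "n < N"
  shows "(\<Sum>s<2 * N. (-1) ^ triangular s * real (num_partitions (int n - int (r * triangular s))))
       = real (num_restricted_partitions r n)"
proof -
  define Q where "Q = (fps_X :: real fps) ^ r"
  \<comment> \<open>The sign turns \<open>x^(T_s)\<close> into the alternating term and
    \<open>1 + x^(2m+1)\<close> into \<open>1 - Q^(2m+1)\<close>.\<close>
  define x where "x = - Q"
  define P where "P = partitions_fps {0<..}"
  define A where "A = allowed_parts r"
  \<comment> \<open>\<open>B\<close> and \<open>C\<close> truncate the multiples of \<open>r\<close>
    and the allowed multiples of \<open>r\<close>; up to \<open>n\<close> nothing is
    missing.\<close>
  define B where "B = (\<lambda>j. r * Suc j) ` {..<2 * N}"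
  define C where "C = (\<lambda>m. r * (4 * m + 2)) ` {..<N}"
  define S where "S = (\<Sum>s<2 * N. x ^ triangular s)"
  define R where "R = (\<Prod>m<N. 1 + x ^ (2 * m + 1))"
  define E where "E = (\<Prod>b\<in>C. 1 - (fps_X :: real fps) ^ b)"
  have Qpow: "Q ^ k = fps_X ^ (r * k)" for k
    by (simp add: Q_def power_mult)
  have xpow: "x ^ k = (-1) ^ k * fps_X ^ (r * k)" for k
    by (simp add: x_def Qpow[symmetric] power_minus[of Q])
  have evenpow: "x ^ (2 * k) = Q ^ (2 * k)" and oddpow: "x ^ (2 * k + 1) = - (Q ^ (2 * k + 1))" for k
    by (simp_all add: x_def)
  have "inj_on (\<lambda>m. r * (4 * m + 2)) {..<N}" using r by (auto simp: inj_on_def)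
  \<comment> \<open>Difference of squares:
    \<open>1 - Q^(4m+2) = (1 + Q^(2m+1)) (1 - Q^(2m+1))\<close>.\<close>
  then have E: "E = (\<Prod>m<N. 1 - x ^ (2 * m + 1)) * R"
  proof -
    have "1 - fps_X ^ (r * (4 * m + 2)) = (1 - x ^ (2 * m + 1)) * (1 + x ^ (2 * m + 1))" for m
    proof -
      have "fps_X ^ (r * (4 * m + 2)) = Q ^ (2 * m + 1) * Q ^ (2 * m + 1)"
        unfolding Qpow[symmetric] power_add[symmetric] by (rule arg_cong[of _ _ "power Q"]) simp
      then show ?thesis unfolding oddpow by (simp add: algebra_simps)
    qed
    with \<open>inj_on _ _\<close> show ?thesis
      by (simp add: E_def C_def R_def prod.reindex prod.distrib del: power_Suc)
  qed
  \<comment> \<open>The weight at \<open>s = 0\<close> supplies the even factors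
    \<open>1 - Q^(2m+2)\<close>, and \<open>R\<close> the odd ones.\<close>
  have W0: "shanks_weight x N 0 * R = (\<Prod>b\<in>B. 1 - fps_X ^ b)"
  proof -
    have "inj_on (\<lambda>j. r * Suc j) {..<2 * N}" using r by (auto simp: inj_on_def)
    then have "(\<Prod>b\<in>B. 1 - fps_X ^ b) = (\<Prod>j<2 * N. 1 - Q ^ Suc j)"
      by (simp add: B_def prod.reindex Qpow del: power_Suc mult_Suc_right)
    also have "\<dots> = (\<Prod>m<N. (1 - x ^ (2 * m + 2)) * (1 + x ^ (2 * m + 1)))"
    proof (induction N)
      case (Suc N)
      have "x ^ (2 * N + 2) = Q ^ Suc (Suc (2 * N))" using evenpow[of "Suc N"] by simp
      then show ?case using Suc oddpow[of N] by (simp del: power_Suc add: mult_ac)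
    qed simp
    finally show ?thesis by (simp add: shanks_weight_def R_def prod.distrib atLeast0LessThan)
  qed
  define V where "V = (\<Sum>s=1..<N. shanks_weight x N s * x ^ (s * (2 * N + 1)))"
  have ES: "E * S = (shanks_weight x N 0 + V) * R"
  proof -
    have "(\<Sum>s<N. shanks_weight x N s * x ^ (s * (2 * N + 1))) = shanks_weight x N 0 + V"
      using N by (simp add: V_def atLeast0LessThan[symmetric] sum.atLeast_Suc_lessThan)
    then show ?thesis
      using shanks_identity[where n = N and x = x] by (simp add: E S_def mult_ac)
  qed
  have PB: "P * (\<Prod>b\<in>B. 1 - fps_X ^ b) = partitions_fps ({0<..} - B)"
  proof -
    have "B \<subseteq> {0<..}" using r by (auto simp: B_def)
    then have "{0<..} - B \<union> B = {0<..}" "0 \<notin> B" by auto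
    then show ?thesis
      using partitions_fps_Un[of B "{0<..} - B"] by (auto simp: P_def B_def)
  qed
  have AE: "partitions_fps A * E = partitions_fps (A - C)"
  proof -
    have "C \<subseteq> A" using r by (auto simp: C_def A_def allowed_parts_iff)
    moreover have "0 \<notin> A" by (simp add: A_def allowed_parts_def)
    ultimately have "A - C \<union> C = A" "0 \<notin> C" by auto
    then show ?thesis
      using partitions_fps_Un[of C "A - C"] by (auto simp: E_def C_def)
  qed
  have main: "(P * S - partitions_fps A) * E
      = (partitions_fps ({0<..} - B) - partitions_fps (A - C)) + V * (R * P)"
  proof -
    have "(P * S - partitions_fps A) * E = P * (E * S) - partitions_fps A * E"
      by (simp add: algebra_simps)
    also have "\<dots> = P * (shanks_weight x N 0 * R) + V * (R * P) - partitions_fps A * E"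
      unfolding ES by (simp add: algebra_simps)
    finally show ?thesis unfolding W0 PB AE by simp
  qed
  \<comment> \<open>Each term of \<open>V\<close> is divisible by \<open>X^(r(2N+1))\<close>, whose
    degree exceeds \<open>n\<close>.\<close>
  have V0: "V $ i = 0" if "i \<le> n" for i
  proof -
    have "(shanks_weight x N s * x ^ (s * (2 * N + 1))) $ i = 0" if "s \<in> {1..<N}" for s
    proof -
      have "i < r * (s * (2 * N + 1))"
      proof -
        have "i < 1 * (1 * (2 * N + 1))" using \<open>i \<le> n\<close> N by simp
        also have "\<dots> \<le> r * (s * (2 * N + 1))"
          using r that by (intro mult_mono) auto
        finally show ?thesis .
      qed
      then show ?thesis
        by (simp only: xpow mult.assoc[symmetric] fps_X_power_mult_right_nth) simp
    qed
    then show ?thesis by (simp add: V_def fps_sum_nth)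
  qed
  \<comment> \<open>Up to \<open>n\<close> both sets consist of exactly the positive non-multiples
    of \<open>r\<close>.\<close>
  have eq: "partitions_into ({0<..} - B) i = partitions_into (A - C) i" if "i \<le> n" for i
  proof (rule partitions_into_cong)
    fix j assume j: "0 < j" "j \<le> i"
    have "j < N" using j that N by simp
    have "j \<in> B \<longleftrightarrow> r dvd j"
    proof
      assume "r dvd j"
      then obtain c where c: "j = r * c" by blast
      then have "c > 0" "c \<le> j" using j r by auto
      then have "c - 1 < 2 * N" using \<open>j < N\<close> by linarith
      then have "j = r * Suc (c - 1)" "c - 1 \<in> {..<2 * N}" using c \<open>c > 0\<close> by simp_all
      then show "j \<in> B" unfolding B_def by (rule image_eqI)
    next
      assume "j \<in> B"
      then show "r dvd j" unfolding B_def by (metis dvd_triv_left imageE)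
    qed
    moreover have "j \<in> C \<longleftrightarrow> (\<exists>m. j = r * (4 * m + 2))"
    proof
      assume "\<exists>m. j = r * (4 * m + 2)"
      then obtain m where m: "j = r * (4 * m + 2)" by blast
      have "1 * (4 * m + 2) \<le> r * (4 * m + 2)" using r by (intro mult_right_mono) auto
      then have "4 * m + 2 \<le> j" using m by simp
      then have "m < N" using \<open>j < N\<close> by linarith
      then show "j \<in> C" using m by (auto simp: C_def)
    qed (auto simp: C_def)
    ultimately show "j \<in> {0<..} - B \<longleftrightarrow> j \<in> A - C"
      using j r allowed_parts_iff[of j r] by (auto simp: A_def)
  qed
  have "((P * S - partitions_fps A) * E) $ i = 0" if "i \<le> n" for i
    unfolding main using that eq[OF that] fps_nth_mult_eq_0[of i V "R * P"] V0
    by (simp add: partitions_fps_def)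
  then have "((P * S - partitions_fps A) * E * inverse E) $ n = 0"
    by (rule fps_nth_mult_eq_0)
  moreover have "E $ 0 \<noteq> 0"
  proof -
    have "(\<Prod>b\<in>D. 1 - (fps_X :: real fps) ^ b) $ 0 = (\<Prod>b\<in>D. (1 - (fps_X :: real fps) ^ b) $ 0)" for D
      by (induction D rule: infinite_finite_induct) simp_all
    then have "E $ 0 = (\<Prod>b\<in>C. (1 - (fps_X :: real fps) ^ b) $ 0)"
      by (simp add: E_def)
    also have "\<dots> = 1" using r by (intro prod.neutral) (auto simp: C_def)
    finally show ?thesis by simp
  qed
  ultimately have "(P * S) $ n = partitions_fps A $ n"
    by (simp add: mult.assoc inverse_mult_eq_1')
  also have "partitions_fps A $ n = real (num_restricted_partitions r n)"
    by (simp add: partitions_fps_def A_def num_restricted_partitions_eq)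
  also have "(P * S) $ n = (\<Sum>s<2 * N. (-1) ^ triangular s *
      real (num_partitions (int n - int (r * triangular s))))"
  proof -
    have into: "partitions_into {0<..} m = partitions m" for m
      by (auto simp: partitions_into_def partitions_def) (metis gr0I)
    have "(P * x ^ k) $ n = (-1) ^ k * real (num_partitions (int n - int (r * k)))" for k
    proof -
      have eq: "P * x ^ k = fps_const ((-1) ^ k) * (P * fps_X ^ (r * k))"
        unfolding xpow by (simp add: fps_const_power[symmetric] fps_const_neg[symmetric])
      show ?thesis
        unfolding eq fps_mult_left_const_nth fps_X_power_mult_right_nth num_partitions_diff
        by (simp add: P_def partitions_fps_def into)
    qed
    then show ?thesis by (simp add: S_def sum_distrib_left fps_sum_nth del: of_nat_mult)
  qed
  finally show ?thesis .
qed

section \<open>Separating the two sums by the parity of triangular numbers\<close>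

lemma even_triangular:
  "even (triangular (4 * k))" "odd (triangular (4 * k + 1))"
  "odd (triangular (4 * k + 2))" "even (triangular (4 * k + 3))"
proof -
  \<comment> \<open>\<open>T_(4k) = 2k(4k+1)\<close> is even; the next increments are odd, even,
    odd.\<close>
  show "even (triangular (4 * k))"
    using triangular_double[of "2 * k"] by simp
  moreover have "triangular (4 * k + 1) = triangular (4 * k) + (4 * k + 1)"
    "triangular (4 * k + 2) = triangular (4 * k + 1) + (4 * k + 2)"
    "triangular (4 * k + 3) = triangular (4 * k + 2) + (4 * k + 3)"
  proof -
    have "4 * k + 1 = Suc (4 * k)" "4 * k + 2 = Suc (4 * k + 1)" "4 * k + 3 = Suc (4 * k + 2)"
      by simp_all
    then show "triangular (4 * k + 1) = triangular (4 * k) + (4 * k + 1)"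
      "triangular (4 * k + 2) = triangular (4 * k + 1) + (4 * k + 2)"
      "triangular (4 * k + 3) = triangular (4 * k + 2) + (4 * k + 3)"
      by (metis triangular_Suc)+
  qed
  ultimately show "odd (triangular (4 * k + 1))" "odd (triangular (4 * k + 2))"
    "even (triangular (4 * k + 3))"
    by presburger+
qed

lemma sum_lessThan_mult_4:
  fixes f :: "nat \<Rightarrow> 'a::comm_monoid_add"
  shows "(\<Sum>s<4 * M. f s) = (\<Sum>k<M. f (4 * k) + f (4 * k + 1) + f (4 * k + 2) + f (4 * k + 3))"
proof (induction M)
  case (Suc M)
  have "4 * Suc M = Suc (Suc (Suc (Suc (4 * M))))" by simp
  then show ?case using Suc by (simp only: sum.lessThan_Suc) (simp add: add_ac numeral_eq_Suc)
qed simp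

theorem theorem2:
  fixes n r :: nat
  assumes "r \<ge> 1"
  shows "((\<lambda>k. real (num_partitions (int n - int (r * triangular (4 * k)))
                 + num_partitions (int n - int (r * triangular (4 * k + 3)))))
           sums (real (least_gap_sum r n) / 2 + real (num_restricted_partitions r n) / 2))
       \<and> ((\<lambda>k. real (num_partitions (int n - int (r * triangular (4 * k + 1)))
                 + num_partitions (int n - int (r * triangular (4 * k + 2)))))
           sums (real (least_gap_sum r n) / 2 - real (num_restricted_partitions r n) / 2))"
proof -
  define p where "p s = real (num_partitions (int n - int (r * triangular s)))" for s
  \<comment> \<open>\<open>n + 1\<close> blocks of four indices suffice, as terms of index above
    \<open>n\<close> vanish.\<close>
  define M where "M = Suc n"
  define a where "a = (\<Sum>k<M. p (4 * k) + p (4 * k + 3))"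
  define b where "b = (\<Sum>k<M. p (4 * k + 1) + p (4 * k + 2))"
  have p0: "p s = 0" if "n < s" for s
    using num_partitions_eq_0[OF assms that] by (simp add: p_def)
  have "a + b = (\<Sum>s<4 * M. p s)"
    by (simp add: a_def b_def sum_lessThan_mult_4 sum.distrib[symmetric] add_ac)
  also have "\<dots> = real (least_gap_sum r n)"
    using sum_num_partitions_eq_least_gap_sum[OF assms, of n "4 * M"]
    by (simp add: p_def M_def flip: of_nat_sum)
  finally have add: "a + b = real (least_gap_sum r n)" .
  \<comment> \<open>The alternating sum runs over \<open>2 * N\<close> indices;
    \<open>N = 2 * M\<close> matches \<open>4 * M\<close>.\<close>
  have "n < 2 * M" by (simp add: M_def)
  have "a - b = (\<Sum>s<4 * M. (-1) ^ triangular s * p s)"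
    by (simp only: a_def b_def sum_lessThan_mult_4 minus_one_power_iff even_triangular
        sum_subtractf[symmetric]) (simp add: algebra_simps)
  also have "\<dots> = real (num_restricted_partitions r n)"
    using alternating_sum_num_partitions[OF assms \<open>n < 2 * M\<close>] by (simp add: p_def)
  finally have diff: "a - b = real (num_restricted_partitions r n)" .
  have "(\<lambda>k. p (4 * k) + p (4 * k + 3)) sums a" "(\<lambda>k. p (4 * k + 1) + p (4 * k + 2)) sums b"
    unfolding a_def b_def by (rule sums_finite; simp add: p0 M_def)+
  moreover have "a = real (least_gap_sum r n) / 2 + real (num_restricted_partitions r n) / 2"
    "b = real (least_gap_sum r n) / 2 - real (num_restricted_partitions r n) / 2"
    using add diff by linarith+
  ultimately show ?thesis by (simp add: p_def)
qed

end
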